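(* Let $n\ge 3$, let $t$ be an indeterminate, and let $\eta'_1: VST_n \to \mathrm{GL}_n(\mathbb{Z}[t^{\pm1}])$ be a homogeneous $2$-local representation of the virtual singular twin group $VST_n$ that extends the representation $\eta_1: T_n\to \mathrm{GL}_n(\mathbb{Z}[t^{\pm 1}])$ of the twin group. Then there is an invertible element $v(t)$ of $\mathbb{Z}[t^{\pm1}]$ such that, for all $1\le i\le n-1$, $$\eta_1'(s_i)=\begin{pmatrix} I_{i-1}&0&0&0\\0&1-t&t&0\\0&2-t&t-1&0\\0&0&0&I_{n-i-1}\end{pmatrix},\qquad \eta_1'(\tau_i)=I_n,\qquad \eta_1'(\nu_i)=\begin{pmatrix} I_{i-1}&0&0&0\\0&0&v(t)&0\\0&\frac{1}{v(t)}&0&0\\0&0&0&I_{n-i-1}\end{pmatrix}.$$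
   Context: The virtual singular twin group $VST_n$ is the group generated by $s_i,\tau_i,\nu_i$ ($1\le i\le n-1$) subject to: $s_i^2=1$, $\nu_i^2=1$ and $\tau_is_i=s_i\tau_i$ for all $i$; $s_is_j\tau_i=\tau_js_is_j$, $\nu_i\nu_j\nu_i=\nu_j\nu_i\nu_j$, $\nu_is_j\nu_i=\nu_js_i\nu_j$, $\nu_i\tau_j\nu_i=\nu_j\tau_i\nu_j$ for $|i-j|=1$; and $g_ih_j=h_jg_i$ for $|i-j|\ge 2$, where $g_i,h_i\in\{s_i,\tau_i,\nu_i\}$. The twin group $T_n$ is the group generated by $s_1,\dots,s_{n-1}$ with relations $s_i^2=1$ for all $i$ and $s_is_j=s_js_i$ for $|i-j|\ge2$. The representation $\eta_1:T_n\to\mathrm{GL}_n(\mathbb{Z}[t^{\pm1}])$ is defined by letting $\eta_1(s_i)$ be the block diagonal matrix with diagonal blocks $I_{i-1}$, $\begin{pmatrix}1-t&t\\2-t&t-1\end{pmatrix}$, $I_{n-i-1}$. A representation $\theta:VST_n\to \mathrm{GL}_n(\mathbb{Z}[t^{\pm1}])$ is homogeneous $2$-local if there are $2\times2$ invertible matrices $S,T,V$ over $\mathbb{Z}[t^{\pm1}]$, independent of $i$, such that for all $1\le i\le n-1$ the matrices $\theta(s_i),\theta(\tau_i),\theta(\nu_i)$ are block diagonal with diagonal blocks $(I_{i-1},S,I_{n-i-1})$, $(I_{i-1},T,I_{n-i-1})$, $(I_{i-1},V,I_{n-i-1})$ respectively. It extends $\eta_1$ if $\theta(s_i)=\eta_1(s_i)$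 for all $i$. $I_r$ is the $r\times r$ identity matrix. *)

theory Defs
  imports "Jordan_Normal_Form.Matrix" "HOL-Library.Poly_Mapping"
begin

text \<open>A letter \<open>(g, True)\<close> stands for the generator \<open>g\<close>, a letter \<open>(g, False)\<close> for its formal
  inverse. A relation \<open>l = r\<close> is given as the pair \<open>(l, r)\<close> of words.\<close>

type_synonym 'g gword = "('g \<times> bool) list"

definition gwords :: "'g set \<Rightarrow> 'g gword set" where
  "gwords X = lists (X \<times> UNIV)"

definition pos_word :: "'g list \<Rightarrow> 'g gword" where
  "pos_word gs = map (\<lambda>g. (g, True)) gs"

inductive_set pres_cong :: "'g set \<Rightarrow> ('g gword \<times> 'g gword) set \<Rightarrow> ('g gword \<times> 'g gword) set"
  for X :: "'g set" and R :: "('g gword \<times> 'g gword) set" where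
  refl: "w \<in> gwords X \<Longrightarrow> (w, w) \<in> pres_cong X R"
| sym: "(u, v) \<in> pres_cong X R \<Longrightarrow> (v, u) \<in> pres_cong X R"
| trans: "(u, v) \<in> pres_cong X R \<Longrightarrow> (v, w) \<in> pres_cong X R \<Longrightarrow> (u, w) \<in> pres_cong X R"
| append: "(u, u') \<in> pres_cong X R \<Longrightarrow> (v, v') \<in> pres_cong X R \<Longrightarrow> (u @ v, u' @ v') \<in> pres_cong X R"
| cancel: "g \<in> X \<Longrightarrow> ([(g, e), (g, \<not> e)], []) \<in> pres_cong X R"
| rel: "(u, v) \<in> R \<Longrightarrow> u \<in> gwords X \<Longrightarrow> v \<in> gwords X \<Longrightarrow> (u, v) \<in> pres_cong X R"

definition presented_group ::
  "'g set \<Rightarrow> ('g gword \<times> 'g gword) set \<Rightarrow> 'g gword set monoid" where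
  "presented_group X R =
     \<lparr> carrier = gwords X // pres_cong X R,
       mult = (\<lambda>A B. \<Union>u\<in>A. \<Union>v\<in>B. pres_cong X R `` {u @ v}),
       one = pres_cong X R `` {[]} \<rparr>"

definition pres_gen :: "'g set \<Rightarrow> ('g gword \<times> 'g gword) set \<Rightarrow> 'g \<Rightarrow> 'g gword set" where
  "pres_gen X R g = pres_cong X R `` {pos_word [g]}"

definition letter_eval :: "('a, 'b) monoid_scheme \<Rightarrow> ('g \<Rightarrow> 'a) \<Rightarrow> 'g \<times> bool \<Rightarrow> 'a" where
  "letter_eval G f l = (if snd l then f (fst l) else inv\<^bsub>G\<^esub> f (fst l))"

definition word_eval :: "('a, 'b) monoid_scheme \<Rightarrow> ('g \<Rightarrow> 'a) \<Rightarrow> 'g gword \<Rightarrow> 'a" where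
  "word_eval G f w = foldr (\<lambda>l a. letter_eval G f l \<otimes>\<^bsub>G\<^esub> a) w \<one>\<^bsub>G\<^esub>"

text \<open>The homomorphism on a presented group induced by an assignment \<open>f\<close> of the generators
  that respects the relations; see \<open>presented_hom_in_hom\<close> below.\<close>

definition presented_hom :: "('a, 'b) monoid_scheme \<Rightarrow> ('g \<Rightarrow> 'a) \<Rightarrow> 'g gword set \<Rightarrow> 'a" where
  "presented_hom G f C = word_eval G f (SOME w. w \<in> C)"

lemma gwords_simps [simp]:
  "[] \<in> gwords X"
  "l # w \<in> gwords X \<longleftrightarrow> fst l \<in> X \<and> w \<in> gwords X"
  "u @ v \<in> gwords X \<longleftrightarrow> u \<in> gwords X \<and> v \<in> gwords X"
  by (cases l; auto simp: gwords_def)+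

lemma pos_word_simps [simp]: "pos_word [] = []" "pos_word (g # gs) = (g, True) # pos_word gs"
  by (simp_all add: pos_word_def)

lemma pres_cong_gwords:
  "(u, v) \<in> pres_cong X R \<Longrightarrow> u \<in> gwords X \<and> v \<in> gwords X"
  by (induction rule: pres_cong.induct) auto

lemma equiv_pres_cong: "equiv (gwords X) (pres_cong X R)"
proof (rule equivI)
  show "pres_cong X R \<subseteq> gwords X \<times> gwords X"
    using pres_cong_gwords by (metis mem_Sigma_iff subrelI)
  show "refl_on (gwords X) (pres_cong X R)"
    by (auto simp: refl_on_def intro: pres_cong.refl)
  show "sym (pres_cong X R)" by (auto intro: symI pres_cong.sym)
  show "trans (pres_cong X R)" by (auto intro: transI pres_cong.trans)
qed

lemma pres_class_eq_iff:
  assumes "u \<in> gwords X" "v \<in> gwords X"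
  shows "pres_cong X R `` {u} = pres_cong X R `` {v} \<longleftrightarrow> (u, v) \<in> pres_cong X R"
  using eq_equiv_class_iff[OF equiv_pres_cong assms] .

lemma presented_mult:
  assumes "u \<in> gwords X" "v \<in> gwords X"
  shows "pres_cong X R `` {u} \<otimes>\<^bsub>presented_group X R\<^esub> pres_cong X R `` {v}
           = pres_cong X R `` {u @ v}"
proof -
  have *: "pres_cong X R `` {u' @ v'} = pres_cong X R `` {u @ v}"
    if "(u, u') \<in> pres_cong X R" "(v, v') \<in> pres_cong X R" for u' v'
    using equiv_class_eq[OF equiv_pres_cong pres_cong.append[OF that]] by simp
  have "u \<in> pres_cong X R `` {u}" "v \<in> pres_cong X R `` {v}"
    using assms by (auto intro: pres_cong.refl)
  note self = this
  have inner: "(\<Union>v'\<in>pres_cong X R `` {v}. pres_cong X R `` {u' @ v'})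
      = pres_cong X R `` {u @ v}" if "(u, u') \<in> pres_cong X R" for u'
    by (rule UN_constant_eq[OF self(2)]) (intro ballI *[OF that], simp)
  have "(\<Union>u'\<in>pres_cong X R `` {u}. \<Union>v'\<in>pres_cong X R `` {v}. pres_cong X R `` {u' @ v'})
      = pres_cong X R `` {u @ v}"
    by (rule UN_constant_eq[OF self(1)]) (intro ballI inner, simp)
  then show ?thesis by (simp only: presented_group_def monoid.simps)
qed

lemma presented_carrierE:
  assumes "A \<in> carrier (presented_group X R)"
  obtains u where "u \<in> gwords X" "A = pres_cong X R `` {u}"
  using assms by (auto simp: presented_group_def elim: quotientE)

lemma presented_carrierI [intro]:
  "u \<in> gwords X \<Longrightarrow> pres_cong X R `` {u} \<in> carrier (presented_group X R)"
  by (auto simp: presented_group_def intro: quotientI)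

lemma presented_one: "\<one>\<^bsub>presented_group X R\<^esub> = pres_cong X R `` {[]}"
  by (simp add: presented_group_def)

lemma pres_left_inverse:
  "w \<in> gwords X \<Longrightarrow> \<exists>w' \<in> gwords X. (w' @ w, []) \<in> pres_cong X R"
proof (induction w)
  case Nil
  then show ?case by (auto intro!: bexI[of _ "[]"] pres_cong.refl)
next
  case (Cons l w)
  obtain g e where l: "l = (g, e)" by (cases l)
  from Cons l obtain w' where w': "w' \<in> gwords X" "(w' @ w, []) \<in> pres_cong X R"
    and g: "g \<in> X" and w: "w \<in> gwords X" by auto
  have "([(g, \<not> e), (g, e)], []) \<in> pres_cong X R"
    using pres_cong.cancel[OF g, of "\<not> e"] by simp
  from pres_cong.append[OF pres_cong.refl[OF w'(1)]
      pres_cong.append[OF this pres_cong.refl[OF w]]]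
  have "(w' @ [(g, \<not> e), (g, e)] @ w, w' @ w) \<in> pres_cong X R" by simp
  from pres_cong.trans[OF this w'(2)]
  have "((w' @ [(g, \<not> e)]) @ (l # w), []) \<in> pres_cong X R" by (simp add: l)
  moreover have "w' @ [(g, \<not> e)] \<in> gwords X" using w' g by simp
  ultimately show ?case by blast
qed

lemma group_presented_group: "group (presented_group X R)"
proof (rule groupI)
  fix A B assume "A \<in> carrier (presented_group X R)" "B \<in> carrier (presented_group X R)"
  then show "A \<otimes>\<^bsub>presented_group X R\<^esub> B \<in> carrier (presented_group X R)"
    by (elim presented_carrierE) (auto simp: presented_mult)
next
  show "\<one>\<^bsub>presented_group X R\<^esub> \<in> carrier (presented_group X R)"
    by (auto simp: presented_one)
next
  fix A B C
  assume "A \<in> carrier (presented_group X R)" "B \<in> carrier (presented_group X R)"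
    "C \<in> carrier (presented_group X R)"
  then show "A \<otimes>\<^bsub>presented_group X R\<^esub> B \<otimes>\<^bsub>presented_group X R\<^esub> C
      = A \<otimes>\<^bsub>presented_group X R\<^esub> (B \<otimes>\<^bsub>presented_group X R\<^esub> C)"
    by (elim presented_carrierE) (simp add: presented_mult)
next
  fix A assume "A \<in> carrier (presented_group X R)"
  then show "\<one>\<^bsub>presented_group X R\<^esub> \<otimes>\<^bsub>presented_group X R\<^esub> A = A"
    by (elim presented_carrierE) (simp add: presented_one presented_mult)
next
  fix A assume "A \<in> carrier (presented_group X R)"
  then obtain u where u: "u \<in> gwords X" "A = pres_cong X R `` {u}"
    by (rule presented_carrierE)
  from pres_left_inverse[OF u(1), of R] obtain w where
    w: "w \<in> gwords X" "(w @ u, []) \<in> pres_cong X R" by blast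
  have "pres_cong X R `` {w} \<otimes>\<^bsub>presented_group X R\<^esub> A = \<one>\<^bsub>presented_group X R\<^esub>"
    using u w by (simp add: presented_one presented_mult pres_class_eq_iff)
  then show "\<exists>B\<in>carrier (presented_group X R).
      B \<otimes>\<^bsub>presented_group X R\<^esub> A = \<one>\<^bsub>presented_group X R\<^esub>"
    using w by blast
qed

context group
begin

lemma letter_eval_closed:
  "\<lbrakk>f ` X \<subseteq> carrier G; fst l \<in> X\<rbrakk> \<Longrightarrow> letter_eval G f l \<in> carrier G"
  by (auto simp: letter_eval_def)

lemma word_eval_closed:
  assumes f: "f ` X \<subseteq> carrier G" and w: "w \<in> gwords X"
  shows "word_eval G f w \<in> carrier G"
  using w
proof (induction w)
  case (Cons l w)
  then show ?case using letter_eval_closed[OF f, of l] by (simp add: word_eval_def)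
qed (simp add: word_eval_def)

lemma word_eval_append:
  assumes f: "f ` X \<subseteq> carrier G" and "u \<in> gwords X" and v: "v \<in> gwords X"
  shows "word_eval G f (u @ v) = word_eval G f u \<otimes> word_eval G f v"
  using assms(2)
proof (induction u)
  case Nil
  then show ?case using word_eval_closed[OF f v] by (simp add: word_eval_def)
next
  case (Cons l u)
  then show ?case
    using letter_eval_closed[OF f, of l] word_eval_closed[OF f v] word_eval_closed[OF f, of u]
    by (simp add: word_eval_def m_assoc)
qed

lemma word_eval_cong:
  assumes f: "f ` X \<subseteq> carrier G"
    and R: "\<And>u v. (u, v) \<in> R \<Longrightarrow> word_eval G f u = word_eval G f v"
    and "(u, v) \<in> pres_cong X R"
  shows "word_eval G f u = word_eval G f v"
  using assms(3)
proof (induction rule: pres_cong.induct)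
  case (append u u' v v')
  then show ?case
    using word_eval_append[OF f] pres_cong_gwords by metis
next
  case (cancel g e)
  then have "f g \<in> carrier G" using f by blast
  then show ?case by (cases e) (simp_all add: word_eval_def letter_eval_def)
qed (auto intro: R)

lemma presented_hom_class:
  assumes f: "f ` X \<subseteq> carrier G"
    and R: "\<And>u v. (u, v) \<in> R \<Longrightarrow> word_eval G f u = word_eval G f v"
    and w: "w \<in> gwords X"
  shows "presented_hom G f (pres_cong X R `` {w}) = word_eval G f w"
proof -
  have "w \<in> pres_cong X R `` {w}" using w by (auto intro: pres_cong.refl)
  then have "(SOME w'. w' \<in> pres_cong X R `` {w}) \<in> pres_cong X R `` {w}"
    by (rule someI)
  then have "(w, SOME w'. w' \<in> pres_cong X R `` {w}) \<in> pres_cong X R" by simp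
  from word_eval_cong[OF f R this] show ?thesis by (simp add: presented_hom_def)
qed

lemma presented_hom_in_hom:
  assumes f: "f ` X \<subseteq> carrier G"
    and R: "\<And>u v. (u, v) \<in> R \<Longrightarrow> word_eval G f u = word_eval G f v"
  shows "presented_hom G f \<in> hom (presented_group X R) G"
proof (rule homI)
  fix A assume "A \<in> carrier (presented_group X R)"
  then show "presented_hom G f A \<in> carrier G"
    by (elim presented_carrierE) (simp add: presented_hom_class[OF f R] word_eval_closed[OF f])
next
  fix A B
  assume "A \<in> carrier (presented_group X R)" "B \<in> carrier (presented_group X R)"
  then show "presented_hom G f (A \<otimes>\<^bsub>presented_group X R\<^esub> B)
      = presented_hom G f A \<otimes> presented_hom G f B"
    by (elim presented_carrierE)
      (simp add: presented_mult presented_hom_class[OF f R] word_eval_append[OF f])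
qed

lemma presented_hom_gen:
  assumes f: "f ` X \<subseteq> carrier G"
    and R: "\<And>u v. (u, v) \<in> R \<Longrightarrow> word_eval G f u = word_eval G f v"
    and g: "g \<in> X"
  shows "presented_hom G f (pres_gen X R g) = f g"
proof -
  have "f g \<in> carrier G" using f g by blast
  then show ?thesis
    unfolding pres_gen_def using g
    by (subst presented_hom_class[OF f R]) (simp_all add: word_eval_def letter_eval_def)
qed

end


definition twin_rels :: "nat \<Rightarrow> (nat gword \<times> nat gword) set" where
  "twin_rels n =
     {(pos_word [i, i], []) | i. i \<in> {1..<n}}
   \<union> {(pos_word [i, j], pos_word [j, i]) | i j. i \<in> {1..<n} \<and> j \<in> {1..<n} \<and> \<bar>int i - int j\<bar> \<ge> 2}"

definition twin_group :: "nat \<Rightarrow> nat gword set monoid" where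
  "twin_group n = presented_group {1..<n} (twin_rels n)"

definition twin_s :: "nat \<Rightarrow> nat \<Rightarrow> nat gword set" where
  "twin_s n i = pres_gen {1..<n} (twin_rels n) i"

datatype vst_gen = Sg nat | Tau nat | Nu nat

definition vst_gens :: "nat \<Rightarrow> vst_gen set" where
  "vst_gens n = Sg ` {1..<n} \<union> Tau ` {1..<n} \<union> Nu ` {1..<n}"

definition vst_rels :: "nat \<Rightarrow> (vst_gen gword \<times> vst_gen gword) set" where
  "vst_rels n =
     (\<Union>i\<in>{1..<n}.
       {(pos_word [Sg i, Sg i], []),
        (pos_word [Nu i, Nu i], []),
        (pos_word [Tau i, Sg i], pos_word [Sg i, Tau i])})
   \<union> (\<Union>i\<in>{1..<n}. \<Union>j\<in>{j\<in>{1..<n}. \<bar>int i - int j\<bar> = 1}.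
       {(pos_word [Sg i, Sg j, Tau i], pos_word [Tau j, Sg i, Sg j]),
        (pos_word [Nu i, Nu j, Nu i], pos_word [Nu j, Nu i, Nu j]),
        (pos_word [Nu i, Sg j, Nu i], pos_word [Nu j, Sg i, Nu j]),
        (pos_word [Nu i, Tau j, Nu i], pos_word [Nu j, Tau i, Nu j])})
   \<union> (\<Union>i\<in>{1..<n}. \<Union>j\<in>{j\<in>{1..<n}. \<bar>int i - int j\<bar> \<ge> 2}.
       {(pos_word [g i, h j], pos_word [h j, g i]) | g h. g \<in> {Sg, Tau, Nu} \<and> h \<in> {Sg, Tau, Nu}})"

definition VST :: "nat \<Rightarrow> vst_gen gword set monoid" where
  "VST n = presented_group (vst_gens n) (vst_rels n)"

definition vst_gen_class :: "nat \<Rightarrow> vst_gen \<Rightarrow> vst_gen gword set" where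
  "vst_gen_class n g = pres_gen (vst_gens n) (vst_rels n) g"


text \<open>The ring of Laurent polynomials with integer coefficients is the group ring of the additive
  group of the integers: finitely supported functions from exponents to coefficients, with the
  convolution product.\<close>

type_synonym laurent = "int \<Rightarrow>\<^sub>0 int"

definition tvar :: laurent where
  "tvar = Poly_Mapping.single 1 1"

definition GL :: "nat \<Rightarrow> laurent mat monoid" where
  "GL n = units_of (ring_mat TYPE(laurent) n ())"

definition local_mat :: "nat \<Rightarrow> nat \<Rightarrow> laurent mat \<Rightarrow> laurent mat" where
  "local_mat n i A = diag_block_mat [1\<^sub>m (i - 1), A, 1\<^sub>m (n - i - 1)]"

definition eta1_block :: "laurent mat" where
  "eta1_block = mat_of_rows_list 2 [[1 - tvar, tvar], [2 - tvar, tvar - 1]]"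

definition eta1 :: "nat \<Rightarrow> nat gword set \<Rightarrow> laurent mat" where
  "eta1 n = presented_hom (GL n) (\<lambda>i. local_mat n i eta1_block)"

definition homogeneous_2_local_rep :: "nat \<Rightarrow> (vst_gen gword set \<Rightarrow> laurent mat) \<Rightarrow> bool" where
  "homogeneous_2_local_rep n \<theta> \<longleftrightarrow>
     \<theta> \<in> hom (VST n) (GL n) \<and>
     (\<exists>A B C. A \<in> carrier (GL 2) \<and> B \<in> carrier (GL 2) \<and> C \<in> carrier (GL 2) \<and>
        (\<forall>i\<in>{1..<n}.
           \<theta> (vst_gen_class n (Sg i)) = local_mat n i A \<and>
           \<theta> (vst_gen_class n (Tau i)) = local_mat n i B \<and>
           \<theta> (vst_gen_class n (Nu i)) = local_mat n i C))"

definition extends_eta1 :: "nat \<Rightarrow> (vst_gen gword set \<Rightarrow> laurent mat) \<Rightarrow> bool" where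
  "extends_eta1 n \<theta> \<longleftrightarrow>
     (\<forall>i\<in>{1..<n}. \<theta> (vst_gen_class n (Sg i)) = eta1 n (twin_s n i))"

lemma group_GL: "group (GL n)"
proof -
  interpret ring "ring_mat TYPE(laurent) n ()" by (rule ring_mat)
  show ?thesis unfolding GL_def by (rule units_group)
qed

lemma GL_simps [simp]:
  "A \<otimes>\<^bsub>GL n\<^esub> B = A * B" "\<one>\<^bsub>GL n\<^esub> = 1\<^sub>m n"
  by (simp_all add: GL_def units_of_def ring_mat_def)

lemma mem_GL_iff:
  "A \<in> carrier (GL n) \<longleftrightarrow>
     A \<in> carrier_mat n n \<and> (\<exists>B\<in>carrier_mat n n. B * A = 1\<^sub>m n \<and> A * B = 1\<^sub>m n)"
  by (auto simp: GL_def units_of_def Units_def ring_mat_def)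

lemma local_mat_carrier:
  assumes "i \<in> {1..<n}" "A \<in> carrier_mat 2 2"
  shows "local_mat n i A \<in> carrier_mat n n"
proof -
  have "dim_row (local_mat n i A) = n" "dim_col (local_mat n i A) = n"
    using assms unfolding local_mat_def by (simp_all only: dim_diag_block_mat) auto
  then show ?thesis by auto
qed

lemma local_mat_four_block:
  assumes "A \<in> carrier_mat 2 2"
  shows "local_mat n i A = four_block_mat (1\<^sub>m (i - 1)) (0\<^sub>m (i - 1) (2 + (n - i - 1)))
      (0\<^sub>m (2 + (n - i - 1)) (i - 1))
      (four_block_mat A (0\<^sub>m 2 (n - i - 1)) (0\<^sub>m (n - i - 1) 2) (1\<^sub>m (n - i - 1)))"
  using assms unfolding local_mat_def
  by (simp add: Let_def diag_block_mat.simps(2)[of _ "_ # _"] del: diag_block_mat.simps)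

lemma local_mat_index:
  assumes "i \<in> {1..<n}" "A \<in> carrier_mat 2 2" "p < n" "q < n"
  shows "local_mat n i A $$ (p, q) =
    (if p \<in> {i - 1, i} \<and> q \<in> {i - 1, i} then A $$ (p - (i - 1), q - (i - 1))
     else if p = q then 1 else 0)"
proof -
  from assms obtain k where i: "i = Suc k" by (cases i) auto
  from assms i obtain m where n: "n = k + 2 + m"
    by (auto simp: less_iff_Suc_add)
  have A: "dim_row A = 2" "dim_col A = 2" using assms by auto
  have split: "r < k \<or> r = k \<or> r = Suc k \<or> (\<exists>d. r = k + 2 + d \<and> d < m)" if "r < n" for r
    using that n by presburger
  show ?thesis
    unfolding local_mat_four_block[OF assms(2)] i n
    using split[OF assms(3)] split[OF assms(4)] A
    by (elim disjE exE conjE) simp_all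
qed

lemma mult_block_diag:
  fixes P Q :: "'a :: semiring_1 mat"
  assumes P: "P \<in> carrier_mat r r" "P' \<in> carrier_mat r r"
    and Q: "Q \<in> carrier_mat q q" "Q' \<in> carrier_mat q q"
  shows "four_block_mat P (0\<^sub>m r q) (0\<^sub>m q r) Q * four_block_mat P' (0\<^sub>m r q) (0\<^sub>m q r) Q'
    = four_block_mat (P * P') (0\<^sub>m r q) (0\<^sub>m q r) (Q * Q')"
proof -
  have [simp]: "P * P' \<in> carrier_mat r r" "Q * Q' \<in> carrier_mat q q"
    using P Q by auto
  show ?thesis
    by (subst mult_four_block_mat[OF P(1) zero_carrier_mat zero_carrier_mat Q(1)
          P(2) zero_carrier_mat zero_carrier_mat Q(2)])
      (simp add: left_mult_zero_mat[OF Q(2)] left_mult_zero_mat[OF P(2)]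
        right_mult_zero_mat[OF P(1)] right_mult_zero_mat[OF Q(1)]
        left_mult_zero_mat[OF zero_carrier_mat] right_add_zero_mat[of _ r r]
        left_add_zero_mat[of _ q q])
qed

lemma local_mat_mult:
  assumes A: "A \<in> carrier_mat 2 2" and B: "B \<in> carrier_mat 2 2"
  shows "local_mat n i A * local_mat n i B = local_mat n i (A * B)"
proof -
  let ?F = "\<lambda>D. four_block_mat D (0\<^sub>m 2 (n - i - 1)) (0\<^sub>m (n - i - 1) 2) (1\<^sub>m (n - i - 1))"
  have C: "?F D \<in> carrier_mat (2 + (n - i - 1)) (2 + (n - i - 1))"
    if "D \<in> carrier_mat 2 2" for D :: "laurent mat"
    using that by (intro four_block_carrier_mat) auto
  have "?F A * ?F B = ?F (A * B)"
    by (subst mult_block_diag[OF A B one_carrier_mat one_carrier_mat]) simp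
  then show ?thesis
    unfolding local_mat_four_block[OF A] local_mat_four_block[OF B]
      local_mat_four_block[OF mult_carrier_mat[OF A B]]
    by (subst mult_block_diag[OF one_carrier_mat one_carrier_mat C[OF A] C[OF B]])
      (simp only: left_mult_one_mat[OF one_carrier_mat])
qed

lemma local_mat_one: "i \<in> {1..<n} \<Longrightarrow> local_mat n i (1\<^sub>m 2) = 1\<^sub>m n"
  using local_mat_carrier[of i n "1\<^sub>m 2"]
  by (intro eq_matI) (auto simp: local_mat_index)

lemma local_mat_far_commute:
  assumes i: "i \<in> {1..<n}" and j: "j \<in> {1..<n}" and far: "\<bar>int i - int j\<bar> \<ge> 2"
    and A: "A \<in> carrier_mat 2 2" and B: "B \<in> carrier_mat 2 2"
  shows "local_mat n i A * local_mat n j B = local_mat n j B * local_mat n i A"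
proof -
  have prod: "(local_mat n i A * local_mat n j B) $$ (p, q) =
      (if p \<in> {i - 1, i} then local_mat n i A $$ (p, q) else local_mat n j B $$ (p, q))"
    if i: "i \<in> {1..<n}" and j: "j \<in> {1..<n}" and far: "\<bar>int i - int j\<bar> \<ge> 2"
      and A: "A \<in> carrier_mat 2 2" and B: "B \<in> carrier_mat 2 2" and p: "p < n" and q: "q < n"
    for i j A B p q
  proof -
    note cA = local_mat_carrier[OF i A] and cB = local_mat_carrier[OF j B]
    have disj: "k \<notin> {j - 1, j}" if "k \<in> {i - 1, i}" for k
      using i j far that by auto
    have "(local_mat n i A * local_mat n j B) $$ (p, q) =
        (\<Sum>k\<in>{0..<n}. local_mat n i A $$ (p, k) * local_mat n j B $$ (k, q))"
      using cA cB p q by (simp add: scalar_prod_def)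
    also have "\<dots> = (if p \<in> {i - 1, i} then local_mat n i A $$ (p, q)
        else local_mat n j B $$ (p, q))"
    proof (cases "p \<in> {i - 1, i}")
      case True
      have "(\<Sum>k\<in>{0..<n}. local_mat n i A $$ (p, k) * local_mat n j B $$ (k, q)) =
          (\<Sum>k\<in>{0..<n}. if k = q then local_mat n i A $$ (p, k) else 0)"
      proof (rule sum.cong)
        fix k assume k: "k \<in> {0..<n}"
        show "local_mat n i A $$ (p, k) * local_mat n j B $$ (k, q) =
            (if k = q then local_mat n i A $$ (p, k) else 0)"
        proof (cases "k \<in> {i - 1, i}")
          case True
          then show ?thesis using disj[OF True] k q
            by (simp add: local_mat_index[OF j B])
        next
          case False
          then have "local_mat n i A $$ (p, k) = 0"
            using True k p by (auto simp: local_mat_index[OF i A])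
          then show ?thesis by auto
        qed
      qed simp
      also have "\<dots> = local_mat n i A $$ (p, q)" using q by simp
      finally show ?thesis using True by simp
    next
      case False
      have "(\<Sum>k\<in>{0..<n}. local_mat n i A $$ (p, k) * local_mat n j B $$ (k, q)) =
          (\<Sum>k\<in>{0..<n}. if k = p then local_mat n j B $$ (k, q) else 0)"
        using False p by (intro sum.cong) (auto simp: local_mat_index[OF i A])
      also have "\<dots> = local_mat n j B $$ (p, q)" using p by simp
      finally show ?thesis by (simp only: False if_False)
    qed
    finally show ?thesis .
  qed
  have far': "\<bar>int j - int i\<bar> \<ge> 2" using far by simp
  show ?thesis
  proof (rule eq_matI)
    fix p q
    assume "p < dim_row (local_mat n j B * local_mat n i A)"
      "q < dim_col (local_mat n j B * local_mat n i A)"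
    then have pq: "p < n" "q < n"
      using local_mat_carrier[OF i A] local_mat_carrier[OF j B] by auto
    have disj: "p \<in> {i - 1, i} \<Longrightarrow> p \<notin> {j - 1, j}"
      using i j far by auto
    show "(local_mat n i A * local_mat n j B) $$ (p, q)
        = (local_mat n j B * local_mat n i A) $$ (p, q)"
      unfolding prod[OF i j far A B pq] prod[OF j i far' B A pq]
    proof (cases "p \<in> {i - 1, i} \<or> p \<in> {j - 1, j}")
      case True
      then show "(if p \<in> {i - 1, i} then local_mat n i A $$ (p, q) else local_mat n j B $$ (p, q))
          = (if p \<in> {j - 1, j} then local_mat n j B $$ (p, q) else local_mat n i A $$ (p, q))"
        using disj by argo
    next
      case False
      then show "(if p \<in> {i - 1, i} then local_mat n i A $$ (p, q) else local_mat n j B $$ (p, q))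
          = (if p \<in> {j - 1, j} then local_mat n j B $$ (p, q) else local_mat n i A $$ (p, q))"
        by (simp only: local_mat_index[OF i A pq] local_mat_index[OF j B pq] de_Morgan_disj
            simp_thms if_False)
    qed
  qed (use local_mat_carrier[OF i A] local_mat_carrier[OF j B] in auto)
qed

lemma local_mat_GL:
  assumes i: "i \<in> {1..<n}" and A: "A \<in> carrier (GL 2)"
  shows "local_mat n i A \<in> carrier (GL n)"
proof -
  from A obtain B where "A \<in> carrier_mat 2 2" "B \<in> carrier_mat 2 2"
    "B * A = 1\<^sub>m 2" "A * B = 1\<^sub>m 2" by (auto simp: mem_GL_iff)
  then show ?thesis
    unfolding mem_GL_iff using i
    by (auto simp: local_mat_mult local_mat_one local_mat_carrier
        intro!: bexI[of _ "local_mat n i B"])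
qed

lemma eta1_block_carrier: "eta1_block \<in> carrier_mat 2 2"
  unfolding eta1_block_def mat_of_rows_list_def by (rule carrier_matI) simp_all

lemma eta1_block_square: "eta1_block * eta1_block = 1\<^sub>m 2"
proof (rule eq_matI)
  fix p q assume "p < dim_row (1\<^sub>m 2 :: laurent mat)" "q < dim_col (1\<^sub>m 2 :: laurent mat)"
  then have "p = 0 \<or> p = 1" "q = 0 \<or> q = 1" by auto
  then show "(eta1_block * eta1_block) $$ (p, q) = 1\<^sub>m 2 $$ (p, q)"
    by (elim disjE)
      (simp_all add: eta1_block_def mat_of_rows_list_def scalar_prod_def algebra_simps)
qed (use eta1_block_carrier in auto)

lemma eta1_block_GL: "eta1_block \<in> carrier (GL 2)"
  using eta1_block_carrier eta1_block_square by (auto simp: mem_GL_iff)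

lemma eta1_well_defined:
  "(\<lambda>i. local_mat n i eta1_block) ` {1..<n} \<subseteq> carrier (GL n)"
  "(u, v) \<in> twin_rels n \<Longrightarrow>
     word_eval (GL n) (\<lambda>i. local_mat n i eta1_block) u
       = word_eval (GL n) (\<lambda>i. local_mat n i eta1_block) v"
proof -
  show "(\<lambda>i. local_mat n i eta1_block) ` {1..<n} \<subseteq> carrier (GL n)"
    using local_mat_GL eta1_block_GL by blast
  assume "(u, v) \<in> twin_rels n"
  then show "word_eval (GL n) (\<lambda>i. local_mat n i eta1_block) u
       = word_eval (GL n) (\<lambda>i. local_mat n i eta1_block) v"
    using eta1_block_carrier
    by (auto simp: twin_rels_def word_eval_def letter_eval_def local_mat_mult local_mat_one
        eta1_block_square local_mat_carrier right_mult_one_mat[OF local_mat_carrier]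
        intro!: local_mat_far_commute)
qed

lemma eta1_hom: "eta1 n \<in> hom (twin_group n) (GL n)"
  unfolding eta1_def twin_group_def
  by (rule group.presented_hom_in_hom[OF group_GL eta1_well_defined])

lemma eta1_twin_s:
  "i \<in> {1..<n} \<Longrightarrow> eta1 n (twin_s n i) = local_mat n i eta1_block"
  unfolding eta1_def twin_s_def
  by (rule group.presented_hom_gen[OF group_GL eta1_well_defined])

end

theory Submission
  imports Defs
begin

text \<open>
  Three relations among the generators of index 1 and 2 already pin down the two unknown blocks,
  once both sides are compared in single entries of the top left corner. Entries are indexed
  from 0.

  Write \<open>x = 1 - t\<close> for the top left entry of the block of \<open>s\<^sub>i\<close>. For the block
  \<open>T\<close> of \<open>\<tau>\<^sub>i\<close>, the relation \<open>s\<^sub>1 s\<^sub>2 \<tau>\<^sub>1 = \<tau>\<^sub>2 s\<^sub>1 s\<^sub>2\<close> contains four equations which, in a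
  domain and because \<open>x \<noteq> 0\<close>, force \<open>T\<close> to be the identity
  (\<open>tau_block_eq_one\<close>). For the block \<open>V\<close> of \<open>\<nu>\<^sub>i\<close>, with diagonal entries \<open>p\<close>
  and \<open>s\<close>, the diagonal of \<open>V\<^sup>2 = 1\<close> gives \<open>p\<^sup>2 = s\<^sup>2\<close>, whereas the central entry of
  \<open>\<nu>\<^sub>1 s\<^sub>2 \<nu>\<^sub>1 = \<nu>\<^sub>2 s\<^sub>1 \<nu>\<^sub>2\<close> gives \<open>x (p\<^sup>2 + s\<^sup>2) = 0\<close>, because the two diagonal entries of
  the block of \<open>s\<^sub>i\<close> are opposite. Hence \<open>2 p\<^sup>2 = 0\<close>, so \<open>p = s = 0\<close>, and \<open>V\<^sup>2 = 1\<close> says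
  that the off-diagonal entries of \<open>V\<close> are inverse to each other
  (\<open>nu_block_antidiagonal\<close>).
\<close>

lemma hom_presented_pos_word:
  assumes "group G" and h: "h \<in> hom (presented_group X R) G" and "set gs \<subseteq> X"
  shows "h (pres_cong X R `` {pos_word gs})
    = foldr (\<lambda>g a. h (pres_gen X R g) \<otimes>\<^bsub>G\<^esub> a) gs \<one>\<^bsub>G\<^esub>"
  using assms(3)
proof (induction gs)
  case Nil
  have "h \<one>\<^bsub>presented_group X R\<^esub> = \<one>\<^bsub>G\<^esub>"
    by (rule hom_one[OF h group_presented_group assms(1)])
  then show ?case by (simp add: presented_one)
next
  case (Cons g gs)
  have g: "pos_word [g] \<in> gwords X" using Cons.prems by simp
  have gs: "pos_word gs \<in> gwords X"
    using Cons.prems by (auto simp: pos_word_def gwords_def)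
  have "h (pres_cong X R `` {pos_word (g # gs)})
      = h (pres_gen X R g \<otimes>\<^bsub>presented_group X R\<^esub> pres_cong X R `` {pos_word gs})"
    unfolding pres_gen_def presented_mult[OF g gs] by simp
  also have "\<dots> = h (pres_gen X R g) \<otimes>\<^bsub>G\<^esub> h (pres_cong X R `` {pos_word gs})"
    by (rule hom_mult[OF h]) (use g gs in \<open>auto simp: pres_gen_def\<close>)
  finally show ?case using Cons by simp
qed

lemma hom_presented_rel:
  assumes "group G" and "h \<in> hom (presented_group X R) G"
    and "(pos_word us, pos_word vs) \<in> R" and "set us \<subseteq> X" and "set vs \<subseteq> X"
  shows "foldr (\<lambda>g a. h (pres_gen X R g) \<otimes>\<^bsub>G\<^esub> a) us \<one>\<^bsub>G\<^esub>
    = foldr (\<lambda>g a. h (pres_gen X R g) \<otimes>\<^bsub>G\<^esub> a) vs \<one>\<^bsub>G\<^esub>"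
proof -
  have w: "pos_word us \<in> gwords X" "pos_word vs \<in> gwords X"
    using assms(4,5) by (auto simp: pos_word_def gwords_def)
  then have "pres_cong X R `` {pos_word us} = pres_cong X R `` {pos_word vs}"
    using assms(3) by (simp add: pres_class_eq_iff pres_cong.rel)
  then show ?thesis
    using hom_presented_pos_word[OF assms(1,2)] assms(4,5) by metis
qed

text \<open>Left multiplication by a local matrix acts on two rows only. Used repeatedly, this
  evaluates single entries of a product of local matrices of arbitrary size.\<close>

lemma local_mat_mult_index:
  assumes i: "i \<in> {1..<n}" and A: "A \<in> carrier_mat 2 2" and N: "N \<in> carrier_mat n n"
    and p: "p < n" and q: "q < n"
  shows "(local_mat n i A * N) $$ (p, q) =
    (if p = i - 1 then A $$ (0, 0) * N $$ (i - 1, q) + A $$ (0, 1) * N $$ (i, q)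
     else if p = i then A $$ (1, 0) * N $$ (i - 1, q) + A $$ (1, 1) * N $$ (i, q)
     else N $$ (p, q))"
proof -
  note L = local_mat_carrier[OF i A]
  have ne: "i - 1 \<noteq> i" "i - 1 < n" "i < n" and [simp]: "i - (i - 1) = 1" using i by auto
  have "(local_mat n i A * N) $$ (p, q)
      = (\<Sum>k\<in>{0..<n}. local_mat n i A $$ (p, k) * N $$ (k, q))"
    using L N p q by (simp add: scalar_prod_def)
  also have "\<dots> = (\<Sum>k\<in>(if p \<in> {i - 1, i} then {i - 1, i} else {p}).
      local_mat n i A $$ (p, k) * N $$ (k, q))"
    using p ne by (intro sum.mono_neutral_right) (auto simp: local_mat_index[OF i A])
  also have "\<dots> = (if p = i - 1 then A $$ (0, 0) * N $$ (i - 1, q) + A $$ (0, 1) * N $$ (i, q)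
     else if p = i then A $$ (1, 0) * N $$ (i - 1, q) + A $$ (1, 1) * N $$ (i, q)
     else N $$ (p, q))"
    using p ne by (auto simp: local_mat_index[OF i A])
  finally show ?thesis .
qed

lemma eta1_block_index:
  "eta1_block $$ (0, 0) = 1 - tvar" "eta1_block $$ (0, 1) = tvar"
  "eta1_block $$ (1, 0) = 2 - tvar" "eta1_block $$ (1, 1) = tvar - 1"
  by (simp_all add: eta1_block_def mat_of_rows_list_def)

lemma one_minus_tvar_nonzero: "1 - tvar \<noteq> 0"
proof
  assume "1 - tvar = 0"
  then have "Poly_Mapping.lookup (1 - tvar) 1 = 0" by simp
  then show False by (simp add: tvar_def lookup_minus lookup_one)
qed

text \<open>The entry \<open>(1, 0)\<close> of the relation reads \<open>x\<^sup>2 c = 0\<close> for the lower left entry \<open>c\<close> of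
  \<open>B\<close>, where \<open>x = 1 - t\<close>. With \<open>c = 0\<close>, the entry \<open>(0, 0)\<close> makes the
  upper left entry of \<open>B\<close> equal to 1; the upper right entry cancels from the entry
  \<open>(1, 1)\<close>, which therefore equates the two diagonal entries of \<open>B\<close>; and \<open>(0, 1)\<close>
  finally makes the upper right entry vanish.\<close>

lemma tau_block_eq_one:
  assumes n: "n \<ge> 3" and B: "B \<in> carrier_mat 2 2"
    and rel: "local_mat n 1 eta1_block * (local_mat n 2 eta1_block * local_mat n 1 B)
      = local_mat n 2 B * (local_mat n 1 eta1_block * local_mat n 2 eta1_block)"
  shows "B = 1\<^sub>m 2"
proof -
  note E = eta1_block_carrier
  have i: "1 \<in> {1..<n}" "2 \<in> {1..<n}" using n by auto
  note C = local_mat_carrier[OF i(1)] local_mat_carrier[OF i(2)]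
  note ev = local_mat_mult_index[OF i(1), unfolded One_nat_def] local_mat_mult_index[OF i(2)]
    local_mat_index[OF i(1), unfolded One_nat_def] local_mat_index[OF i(2)]
    eta1_block_index[unfolded One_nat_def] mult_carrier_mat[of _ n n _ n]
  define x where "x = 1 - tvar"
  have x0: "x \<noteq> 0" using one_minus_tvar_nonzero by (simp add: x_def)
  define a b c d where abcd: "a = B $$ (0, 0)" "b = B $$ (0, 1)" "c = B $$ (1, 0)" "d = B $$ (1, 1)"
  note entry = arg_cong[OF rel, of "\<lambda>M. M $$ (p, q)" for p q]
  have "x * (x * c) = 0"
    using entry[of 1 0] n B E C by (simp add: ev abcd x_def algebra_simps)
  then have c: "c = 0" using x0 by simp
  have "x * a = x * 1"
    using entry[of 0 0] n B E C c by (simp add: ev abcd x_def algebra_simps)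
  then have a: "a = 1" using x0 by simp
  have "x * (x * d) = x * (x * a)"
    using entry[of 1 1] n B E C by (simp add: ev abcd x_def algebra_simps)
  then have d: "d = 1" using x0 a by simp
  have "x * b = 0"
    using entry[of 0 1] n B E C d by (simp add: ev abcd x_def algebra_simps)
  then have b: "b = 0" using x0 by simp
  show ?thesis
  proof (rule eq_matI)
    fix p q assume "p < dim_row (1\<^sub>m 2 :: laurent mat)" "q < dim_col (1\<^sub>m 2 :: laurent mat)"
    then have "p = 0 \<or> p = 1" "q = 0 \<or> q = 1" by auto
    then show "B $$ (p, q) = 1\<^sub>m 2 $$ (p, q)"
      using a b c d by (elim disjE) (simp_all add: abcd)
  qed (use B in auto)
qed

text \<open>The equation \<open>V\<^sup>2 = 1\<close> alone leaves room for nonzero opposite diagonal entries. They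
  are excluded by the central entry of the mixed relation, from which the off-diagonal product
  \<open>q r\<close> cancels; the argument needs that 2 and \<open>1 - t\<close> are not zero divisors.\<close>

lemma nu_block_antidiagonal:
  assumes n: "n \<ge> 3" and V: "V \<in> carrier_mat 2 2"
    and square: "local_mat n 1 V * local_mat n 1 V = 1\<^sub>m n"
    and mixed: "local_mat n 1 V * (local_mat n 2 eta1_block * local_mat n 1 V)
      = local_mat n 2 V * (local_mat n 1 eta1_block * local_mat n 2 V)"
  shows "V = mat_of_rows_list 2 [[0, V $$ (0, 1)], [V $$ (1, 0), 0]]"
    and "V $$ (0, 1) * V $$ (1, 0) = 1"
proof -
  note E = eta1_block_carrier
  have i: "1 \<in> {1..<n}" "2 \<in> {1..<n}" using n by auto
  note C = local_mat_carrier[OF i(1)] local_mat_carrier[OF i(2)]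
  note ev = local_mat_mult_index[OF i(1), unfolded One_nat_def] local_mat_mult_index[OF i(2)]
    local_mat_index[OF i(1), unfolded One_nat_def] local_mat_index[OF i(2)]
    eta1_block_index[unfolded One_nat_def] mult_carrier_mat[of _ n n _ n]
  define x where "x = 1 - tvar"
  have x0: "x \<noteq> 0" using one_minus_tvar_nonzero by (simp add: x_def)
  define p q r s where pqrs: "p = V $$ (0, 0)" "q = V $$ (0, 1)" "r = V $$ (1, 0)" "s = V $$ (1, 1)"
  have pp: "p * p + q * r = 1"
    using arg_cong[OF square, of "\<lambda>M. M $$ (0, 0)"] n V C by (simp add: ev pqrs)
  have ss: "s * s + q * r = 1"
    using arg_cong[OF square, of "\<lambda>M. M $$ (1, 1)"] n V C by (simp add: ev pqrs algebra_simps)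
  have central: "r * q + s * (x * s) = q * r - p * (x * p)"
    using arg_cong[OF mixed, of "\<lambda>M. M $$ (1, 1)"] n V E C
    by (simp add: ev pqrs x_def algebra_simps)
  have "x * (p * p + s * s) = (r * q + s * (x * s)) - (q * r - p * (x * p))"
    by (simp add: algebra_simps)
  then have "x * (p * p + s * s) = 0" using central by simp
  then have "p * p + s * s = 0" using x0 by simp
  moreover have eq: "p * p = s * s" using pp ss by (metis add_right_cancel)
  ultimately have "s * s = 0" by (simp flip: mult_2)
  then have p: "p = 0" and s: "s = 0" using eq by simp_all
  show "V $$ (0, 1) * V $$ (1, 0) = 1" using pp p by (simp add: pqrs)
  show "V = mat_of_rows_list 2 [[0, V $$ (0, 1)], [V $$ (1, 0), 0]]" (is "_ = ?W")
  proof (rule eq_matI)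
    fix k l assume "k < dim_row ?W" "l < dim_col ?W"
    then have "k = 0 \<or> k = 1" "l = 0 \<or> l = 1" by (auto simp: mat_of_rows_list_def)
    then show "V $$ (k, l) = ?W $$ (k, l)"
      using p s by (elim disjE) (simp_all add: pqrs mat_of_rows_list_def)
  qed (use V in \<open>auto simp: mat_of_rows_list_def\<close>)
qed

theorem theorem14:
  fixes n :: nat and \<eta>' :: "vst_gen gword set \<Rightarrow> laurent mat"
  assumes "n \<ge> 3"
    and "homogeneous_2_local_rep n \<eta>'"
    and "extends_eta1 n \<eta>'"
  shows "\<exists>v v_inv :: laurent. v * v_inv = 1 \<and>
    (\<forall>i\<in>{1..n - 1}.
       \<eta>' (vst_gen_class n (Sg i)) = local_mat n i (mat_of_rows_list 2 [[1 - tvar, tvar], [2 - tvar, tvar - 1]]) \<and>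
       \<eta>' (vst_gen_class n (Tau i)) = 1\<^sub>m n \<and>
       \<eta>' (vst_gen_class n (Nu i)) = local_mat n i (mat_of_rows_list 2 [[0, v], [v_inv, 0]]))"
proof -
  from assms(2) obtain B V where hom: "\<eta>' \<in> hom (VST n) (GL n)"
    and "B \<in> carrier (GL 2)" "V \<in> carrier (GL 2)"
    and tau: "\<And>i. i \<in> {1..<n} \<Longrightarrow> \<eta>' (vst_gen_class n (Tau i)) = local_mat n i B"
    and nu: "\<And>i. i \<in> {1..<n} \<Longrightarrow> \<eta>' (vst_gen_class n (Nu i)) = local_mat n i V"
    unfolding homogeneous_2_local_rep_def by blast
  then have B: "B \<in> carrier_mat 2 2" and V: "V \<in> carrier_mat 2 2"
    by (simp_all add: mem_GL_iff)
  have sg: "\<eta>' (vst_gen_class n (Sg i)) = local_mat n i eta1_block" if "i \<in> {1..<n}" for i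
    using assms(3) that by (simp add: extends_eta1_def eta1_twin_s)
  have i: "1 \<in> {1..<n}" "2 \<in> {1..<n}" using assms(1) by auto
  have C: "local_mat n k A \<in> carrier_mat n n"
    if "k \<in> {1, 2}" "A \<in> carrier_mat 2 2" for k A
    using that i local_mat_carrier by auto
  note rel = hom_presented_rel[OF group_GL hom[unfolded VST_def], folded vst_gen_class_def]
  have gens: "Sg k \<in> vst_gens n" "Tau k \<in> vst_gens n" "Nu k \<in> vst_gens n"
    if "k \<in> {1, 2}" for k
    using that i by (auto simp: vst_gens_def)
  have "(pos_word [Sg 1, Sg 2, Tau 1], pos_word [Tau 2, Sg 1, Sg 2]) \<in> vst_rels n"
    "(pos_word [Nu 1, Sg 2, Nu 1], pos_word [Nu 2, Sg 1, Nu 2]) \<in> vst_rels n"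
    "(pos_word [Nu 1, Nu 1], pos_word []) \<in> vst_rels n"
    unfolding vst_rels_def using i by (force, force, force)
  note R = this[THEN rel]
  have eqs: "local_mat n 1 eta1_block * (local_mat n 2 eta1_block * local_mat n 1 B)
      = local_mat n 2 B * (local_mat n 1 eta1_block * local_mat n 2 eta1_block)"
    "local_mat n 1 V * (local_mat n 2 eta1_block * local_mat n 1 V)
      = local_mat n 2 V * (local_mat n 1 eta1_block * local_mat n 2 V)"
    "local_mat n 1 V * local_mat n 1 V = 1\<^sub>m n"
    using R gens i C[OF _ B] C[OF _ V] C[OF _ eta1_block_carrier]
    by (simp_all add: sg tau nu right_mult_one_mat[of _ n n])
  have "B = 1\<^sub>m 2" by (rule tau_block_eq_one[OF assms(1) B eqs(1)])
  note V_form = nu_block_antidiagonal[OF assms(1) V eqs(3,2)]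
  show ?thesis
  proof (intro exI conjI ballI)
    show "V $$ (0, 1) * V $$ (1, 0) = 1" by (rule V_form(2))
    fix i assume "i \<in> {1..n - 1}"
    then have i: "i \<in> {1..<n}" using assms(1) by auto
    show "\<eta>' (vst_gen_class n (Sg i))
        = local_mat n i (mat_of_rows_list 2 [[1 - tvar, tvar], [2 - tvar, tvar - 1]])"
      using sg[OF i] by (simp add: eta1_block_def)
    show "\<eta>' (vst_gen_class n (Tau i)) = 1\<^sub>m n"
      using tau[OF i] \<open>B = 1\<^sub>m 2\<close> local_mat_one[OF i] by simp
    show "\<eta>' (vst_gen_class n (Nu i))
        = local_mat n i (mat_of_rows_list 2 [[0, V $$ (0, 1)], [V $$ (1, 0), 0]])"
      using nu[OF i] V_form(1) by simp
  qed
qed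

end
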